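(* Let $n\equiv 0\pmod 4$, let $p\geq 0$ be an integer with $n\geq 4p+3$, and let $\epsilon$ be a positive integer with $\epsilon\leq (n-4p)/2$ and $\gcd(\epsilon,n)=1$. If there exists an integer $\alpha$ with $\gcd(\alpha,n)=1$ and $2p+\epsilon \leq \alpha\leq n-\epsilon-2p$, then there exists a globally simple Heffter array $H(n;4p+3)$.
   Context: A Heffter array $H(n;k)$ is an $n\times n$ array of integers (some cells may be empty) such that: each row and each column contains exactly $k$ filled cells; the entries in every row and every column sum to $0$ modulo $2nk+1$; and for each integer $1\leq x\leq nk$, either $x$ or $-x$ appears in the array. Rows and columns are indexed by $0,1,\dots,n-1$. The natural ordering of a row lists its filled cells from left to right (increasing column index), and that of a column from top to bottom (increasing row index). The array is globally simple if, for every row and every column, writing its entries in natural order as $a_0,\dots,a_{k-1}$, the partial sums $\sum_{j=0}^{i}a_j$, $i=0,\dots,k-1$, are pairwise distinct modulo $2nk+1$. *)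

theory Defs
  imports Complex_Main "HOL-Number_Theory.Cong"
begin

text \<open>
  An \<open>n \<times> n\<close> array is a function whose values matter only at positions \<open>(i, j)\<close> with
  \<open>i < n\<close> and \<open>j < n\<close>; the value \<^term>\<open>None\<close> marks an empty cell.
\<close>

type_synonym array = "nat \<Rightarrow> nat \<Rightarrow> int option"

definition row_entries :: "nat \<Rightarrow> array \<Rightarrow> nat \<Rightarrow> int list" where
  "row_entries n A i = List.map_filter (\<lambda>j. A i j) [0..<n]"

definition col_entries :: "nat \<Rightarrow> array \<Rightarrow> nat \<Rightarrow> int list" where
  "col_entries n A j = List.map_filter (\<lambda>i. A i j) [0..<n]"

text \<open>
  The disjunction in the last clause may be read inclusively: the array has exactly \<open>n * k\<close>
  filled cells, so by counting exactly one of \<open>x\<close>, \<open>- x\<close> appears, and it appears once.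
\<close>

definition heffter_array :: "nat \<Rightarrow> nat \<Rightarrow> array \<Rightarrow> bool" where
  "heffter_array n k A \<longleftrightarrow>
     (\<forall>i<n. length (row_entries n A i) = k) \<and>
     (\<forall>j<n. length (col_entries n A j) = k) \<and>
     (\<forall>i<n. [sum_list (row_entries n A i) = 0] (mod (2 * int n * int k + 1))) \<and>
     (\<forall>j<n. [sum_list (col_entries n A j) = 0] (mod (2 * int n * int k + 1))) \<and>
     (\<forall>x::int. 1 \<le> x \<and> x \<le> int n * int k \<longrightarrow>
        (\<exists>i<n. \<exists>j<n. A i j = Some x \<or> A i j = Some (- x)))"

definition distinct_partial_sums :: "int \<Rightarrow> int list \<Rightarrow> bool" where
  "distinct_partial_sums m as \<longleftrightarrow>
     (\<forall>r<length as. \<forall>s<length as. r \<noteq> s \<longrightarrow>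
        \<not> [(\<Sum>j=0..r. as ! j) = (\<Sum>j=0..s. as ! j)] (mod m))"

definition globally_simple :: "nat \<Rightarrow> nat \<Rightarrow> array \<Rightarrow> bool" where
  "globally_simple n k A \<longleftrightarrow>
     (\<forall>i<n. distinct_partial_sums (2 * int n * int k + 1) (row_entries n A i)) \<and>
     (\<forall>j<n. distinct_partial_sums (2 * int n * int k + 1) (col_entries n A j))"

end

theory Submission imports Defs begin

text \<open>
  Write \<open>n = 4 * L\<close> and \<open>a = 2 * L - 1\<close>,
  so that \<open>a * a\<close> is \<open>1\<close> modulo \<open>n\<close> and \<open>p < L\<close>. Diagonal \<open>d\<close> consists of the cells
  \<open>(i, i + d)\<close>, indices modulo \<open>n\<close>.

  The diagonals \<open>0, a, 2 * a\<close> carry an integer Heffter array \<open>H(n; 3)\<close>. In row \<open>i\<close>, with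
  \<open>s = a * i\<close>, it has the entries \<open>K - \<zeta> (s - 1)\<close>, \<open>\<zeta> s + \<zeta> (s - 1) - K\<close>, \<open>- \<zeta> s\<close>, where
  \<open>K = 4 * n + 1\<close>; since \<open>a\<close> is its own inverse, columns telescope as well. The cyclic sequence
  \<open>\<zeta>\<close> picks one element of each pair \<open>{v, K - v}\<close> with \<open>n < v \<le> 2 * n\<close>, and
  \<open>\<bar>\<zeta> s + \<zeta> (s - 1) - K\<bar>\<close> covers \<open>1, \<dots>, n\<close>. It is a zigzag of graceful-labelling type, in
  which the two missing differences \<open>n - 1, n\<close> are produced by reflecting the single value at
  \<open>s = L - 1\<close>.

  The other \<open>4 * p\<close> diagonals form two blocks of \<open>2 * p\<close> consecutive ones, between diagonals
  \<open>0\<close> and \<open>a\<close> and between \<open>a\<close> and \<open>2 * a\<close>. They are cut into pairs of adjacent diagonals whose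
  entries have opposite signs, and whose sum \<open>\<delta>\<close> lies strictly between \<open>n\<close> and \<open>3 * n\<close> and is
  the same, up to sign, for all pairs of a line. As the entry on diagonal \<open>a\<close> is nonzero and at
  most \<open>n\<close> in absolute value, the partial sums of the line do not collide.
\<close>

section \<open>Partial sums along a line\<close>

text \<open>Empty cells count as 0, so a sum over the filled cells of a line becomes a sum over all
  its positions.\<close>

definition entry :: "int option \<Rightarrow> int" where
  "entry c = (case c of None \<Rightarrow> 0 | Some x \<Rightarrow> x)"

lemma map_filter_snoc:
  "List.map_filter v [0..<Suc n] = List.map_filter v [0..<n] @ (case v n of None \<Rightarrow> [] | Some x \<Rightarrow> [x])"
  by (simp add: List.map_filter_def split: option.split)

lemma length_map_filter_upt:
  "length (List.map_filter v [0..<n]) = card {t. t < n \<and> v t \<noteq> None}"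
proof (induction n)
  case 0
  then show ?case by (simp add: List.map_filter_def)
next
  case (Suc n)
  have "{t. t < Suc n \<and> v t \<noteq> None} = {t. t < n \<and> v t \<noteq> None} \<union> (if v n = None then {} else {n})"
    by (auto simp: less_Suc_eq)
  with Suc show ?case
    by (auto simp: map_filter_snoc simp del: upt_Suc split: option.split)
qed

lemma sum_list_map_filter_upt:
  "sum_list (List.map_filter v [0..<n]) = (\<Sum>t<n. entry (v t))"
proof (induction n)
  case 0
  then show ?case by (simp add: List.map_filter_def)
next
  case (Suc n)
  then show ?case
    by (auto simp: map_filter_snoc entry_def simp del: upt_Suc split: option.split)
qed

text \<open>The cardinality clause makes \<open>t\<close> determine \<open>r\<close>, so different
  list indices belong to different positions.\<close>

lemma partial_sum_map_filter_upt:
  assumes "r < length (List.map_filter v [0..<n])"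
  shows "\<exists>t<n. v t \<noteq> None \<and> card {u. u < t \<and> v u \<noteq> None} = r \<and>
    (\<Sum>j=0..r. List.map_filter v [0..<n] ! j) = (\<Sum>u\<le>t. entry (v u))"
  using assms
proof (induction n)
  case 0
  then show ?case by (simp add: List.map_filter_def)
next
  case (Suc n)
  let ?as = "List.map_filter v [0..<n]"
  let ?bs = "List.map_filter v [0..<Suc n]"
  show ?case
  proof (cases "r < length ?as")
    case True
    have "(\<Sum>j=0..r. ?bs ! j) = (\<Sum>j=0..r. ?as ! j)"
      using True by (intro sum.cong) (auto simp: map_filter_snoc nth_append simp del: upt_Suc)
    with Suc.IH[OF True] show ?thesis
      using less_Suc_eq by auto
  next
    case False
    with Suc.prems obtain x where x: "v n = Some x" and r: "r = length ?as"
      by (auto simp: map_filter_snoc simp del: upt_Suc split: option.splits)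
    have bs: "?bs = ?as @ [x]" using x by (simp add: map_filter_snoc del: upt_Suc)
    have "(\<Sum>j=0..r. ?bs ! j) = sum_list ?bs"
      using r by (simp add: bs sum_list_sum_nth atLeast0LessThan atLeast0AtMost lessThan_Suc_atMost del: upt_Suc)
    also have "\<dots> = (\<Sum>u\<le>n. entry (v u))"
      by (simp only: sum_list_map_filter_upt lessThan_Suc_atMost)
    finally show ?thesis
      using x r by (intro exI[of _ n]) (simp add: length_map_filter_upt)
  qed
qed

lemma distinct_partial_sums_map_filter_upt:
  assumes "\<And>s t. s < n \<Longrightarrow> t < n \<Longrightarrow> v s \<noteq> None \<Longrightarrow> v t \<noteq> None \<Longrightarrow> s \<noteq> t \<Longrightarrow>
    \<not> [(\<Sum>u\<le>s. entry (v u)) = (\<Sum>u\<le>t. entry (v u))] (mod m)"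
  shows "distinct_partial_sums m (List.map_filter v [0..<n])"
  unfolding distinct_partial_sums_def
proof (intro allI impI)
  fix r s
  let ?as = "List.map_filter v [0..<n]"
  assume r: "r < length ?as" and s: "s < length ?as" and rs: "r \<noteq> s"
  from partial_sum_map_filter_upt[OF r] partial_sum_map_filter_upt[OF s] assms rs
  show "\<not> [(\<Sum>j=0..r. ?as ! j) = (\<Sum>j=0..s. ?as ! j)] (mod m)"
    by metis
qed

section \<open>Rows and columns read along the diagonals\<close>

lemma mod_offset: "i < n \<Longrightarrow> j < n \<Longrightarrow> (j + n - i) mod n = (if i \<le> j then j - i else j + n - i)" for i j n :: nat
  by (auto simp: le_mod_geq mod_if)

text \<open>A row starts on diagonal \<open>(n - i) mod n\<close> and wraps from
  \<open>n - 1\<close> to 0 at column \<open>i\<close>; the wrap costs nothing because the total is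
  0.\<close>

lemma row_partial_sum:
  fixes F :: "nat \<Rightarrow> int"
  assumes i: "i < n" and total: "(\<Sum>d<n. F d) = 0" and j: "j < n"
  shows "(\<Sum>t\<le>j. F ((t + n - i) mod n)) =
    (\<Sum>d<Suc ((j + n - i) mod n). F d) - (\<Sum>d<(n - i) mod n. F d)"
  using j
proof (induction j)
  case 0
  then show ?case by simp
next
  case (Suc j)
  show ?case
  proof (cases "Suc j = i")
    case True
    then have "(Suc j + n - i) mod n = 0" "Suc ((j + n - i) mod n) = n"
      using i Suc.prems by (auto simp: mod_offset)
    with Suc total show ?thesis by (simp del: add_Suc)
  next
    case False
    then have "(Suc j + n - i) mod n = Suc ((j + n - i) mod n)"
      using i Suc.prems by (subst (1 2) mod_offset) auto
    with Suc show ?thesis by (simp del: add_Suc)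
  qed
qed

text \<open>Down a column the diagonals decrease, so the prefix ending just before the current
  diagonal is subtracted; in rows the prefix includes the current one.\<close>

lemma column_partial_sum:
  fixes F :: "nat \<Rightarrow> int"
  assumes j: "j < n" and total: "(\<Sum>d<n. F d) = 0" and i: "i < n"
  shows "(\<Sum>t\<le>i. F ((j + n - t) mod n)) = (\<Sum>d<Suc j. F d) - (\<Sum>d<(j + n - i) mod n. F d)"
  using i
proof (induction i)
  case 0
  then show ?case using j by simp
next
  case (Suc i)
  show ?case
  proof (cases "i = j")
    case True
    then have "(j + n - i) mod n = 0" "Suc ((j + n - Suc i) mod n) = n"
      using j Suc.prems by (auto simp: mod_offset)
    moreover from this(2) have "(\<Sum>d<(j + n - Suc i) mod n. F d) + F ((j + n - Suc i) mod n) = 0"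
      using total by (metis sum.lessThan_Suc)
    ultimately show ?thesis using Suc by simp
  next
    case False
    then have "(j + n - i) mod n = Suc ((j + n - Suc i) mod n)"
      using j Suc.prems by (auto simp: mod_offset)
    with Suc show ?thesis by simp
  qed
qed


section \<open>Injectivity of the partial sums modulo \<open>2 * n * (4 * p + 3) + 1\<close>\<close>

text \<open>
  A row or a column, read cyclically along the diagonals: \<open>F d\<close> is its entry on diagonal \<open>d\<close>
  (\<open>0\<close> if the cell is empty). The pairs of the block on diagonals \<open>1, \<dots>, 2 * p\<close> sum to \<open>\<delta>\<close>,
  those of the block on \<open>a + 1, \<dots>, a + 2 * p\<close> to \<open>- \<delta>\<close>.
\<close>

definition filled :: "nat \<Rightarrow> nat \<Rightarrow> nat set" where
  "filled p a = {..2 * p} \<union> {a..a + 2 * p} \<union> {2 * a}"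

locale heffter_line =
  fixes n p a :: nat and F :: "nat \<Rightarrow> int" and \<delta> :: int
  assumes p_less: "2 * p < a" and a_less: "2 * a < n"
    and delta: "int n < \<delta>" "\<delta> < 3 * int n"
    and first: "int n < F 0" "F 0 \<le> 3 * int n"
    and middle: "F a \<noteq> 0" "\<bar>F a\<bar> \<le> int n"
    and last: "F (2 * a) < - int n" "- 3 * int n \<le> F (2 * a)"
    and three: "F 0 + F a + F (2 * a) = 0"
    and up: "b < p \<Longrightarrow> (4 * (int p - int b) + 2) * int n < F (2 * b + 1)"
      "b < p \<Longrightarrow> F (2 * b + 1) \<le> (4 * (int p - int b) + 3) * int n"
      "b < p \<Longrightarrow> F (2 * b + 1) + F (2 * b + 2) = \<delta>"
    and down: "b < p \<Longrightarrow> F (a + 2 * b + 1) < - ((4 * (int p - int b) + 1) * int n)"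
      "b < p \<Longrightarrow> - ((4 * (int p - int b) + 2) * int n) \<le> F (a + 2 * b + 1)"
      "b < p \<Longrightarrow> F (a + 2 * b + 1) + F (a + 2 * b + 2) = - \<delta>"
      "b < p \<Longrightarrow> (4 * (int p - int b) - 1) * int n < F (a + 2 * b + 2)"
    and vanish: "d \<notin> filled p a \<Longrightarrow> F d = 0"
begin

definition Q :: "nat \<Rightarrow> int" where "Q d = (\<Sum>t<d. F t)"

lemma Q_Suc: "Q (Suc d) = Q d + F d"
  by (simp add: Q_def)

lemma Q_const:
  assumes "c \<le> d" and "\<And>t. c \<le> t \<Longrightarrow> t < d \<Longrightarrow> F t = 0"
  shows "Q d = Q c"
  using assms by (induction d rule: dec_induct) (auto simp: Q_Suc)

lemma Q_up: "b \<le> p \<Longrightarrow> Q (2 * b + 1) = F 0 + int b * \<delta>"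
proof (induction b)
  case 0
  then show ?case by (simp add: Q_def)
next
  case (Suc b)
  have "Q (2 * Suc b + 1) = Q (2 * b + 1) + (F (2 * b + 1) + F (2 * b + 2))"
    by (simp add: Q_Suc)
  with Suc up(3)[of b] show ?case by (simp add: algebra_simps)
qed

lemma Q_a: "Q a = F 0 + int p * \<delta>"
proof -
  have "Q a = Q (2 * p + 1)"
    using p_less by (intro Q_const) (auto intro!: vanish simp: filled_def)
  then show ?thesis using Q_up[of p] by simp
qed

lemma Q_down: "b \<le> p \<Longrightarrow> Q (a + 2 * b + 1) = F 0 + F a + (int p - int b) * \<delta>"
proof (induction b)
  case 0
  then show ?case by (simp add: Q_Suc Q_a)
next
  case (Suc b)
  have "Q (a + 2 * Suc b + 1) = Q (a + 2 * b + 1) + (F (a + 2 * b + 1) + F (a + 2 * b + 2))"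
    by (simp add: Q_Suc)
  with Suc down(3)[of b] show ?case by (simp add: algebra_simps)
qed

lemma Q_2a: "Q (2 * a) = F 0 + F a"
proof -
  have "Q (2 * a) = Q (a + 2 * p + 1)"
    using p_less by (intro Q_const) (auto intro!: vanish simp: filled_def)
  then show ?thesis using Q_down[of p] by simp
qed

lemma Q_end: "2 * a < d \<Longrightarrow> Q d = 0"
proof -
  assume "2 * a < d"
  then have "Q d = Q (Suc (2 * a))"
    using p_less by (intro Q_const) (auto intro!: vanish simp: filled_def)
  then show ?thesis using three by (simp add: Q_Suc Q_2a)
qed

lemma Q_0: "Q 0 = 0" and Q_n: "Q n = 0"
  using Q_end a_less by (simp_all add: Q_def)

text \<open>
  The values of the partial sums: \<open>e1\<close> and \<open>e2\<close> between consecutive pairs of the first and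
  the second block, \<open>o1\<close> and \<open>o2\<close> inside the pairs. The estimates below amount to
  \<open>o2 < 0 < e1, e2 < o1\<close>, with \<open>o1\<close> decreasing, \<open>o2\<close> increasing, and \<open>e1\<close> never meeting \<open>e2\<close>
  because \<open>0 < \<bar>F a\<bar> < \<delta>\<close>.
\<close>

definition e1 :: "nat \<Rightarrow> int" where "e1 b = F 0 + int b * \<delta>"
definition o1 :: "nat \<Rightarrow> int" where "o1 b = F 0 + int b * \<delta> + F (2 * b + 1)"
definition e2 :: "nat \<Rightarrow> int" where "e2 b = F 0 + F a + (int p - int b) * \<delta>"
definition o2 :: "nat \<Rightarrow> int" where "o2 b = F 0 + F a + (int p - int b) * \<delta> + F (a + 2 * b + 1)"

lemma delta_bounds:
  assumes "0 \<le> k"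
  shows "k * int n + k \<le> k * \<delta>" "k * \<delta> \<le> 3 * (k * int n) - k"
proof -
  have "k * (int n + 1) \<le> k * \<delta>" "k * \<delta> \<le> k * (3 * int n - 1)"
    using delta assms by (auto intro: mult_left_mono)
  then show "k * int n + k \<le> k * \<delta>" "k * \<delta> \<le> 3 * (k * int n) - k"
    by (simp_all add: algebra_simps)
qed

lemma n_pos: "0 < int n"
  using a_less by simp

lemma mult_n_mono: "k \<le> l \<Longrightarrow> k * int n \<le> l * int n"
  by (simp add: mult_right_mono)

lemma e1_bounds:
  assumes "b \<le> p"
  shows "0 < e1 b" "e1 b \<le> (3 * int p + 3) * int n"
proof -
  have "0 \<le> int b" "int b \<le> int p" using assms by auto
  note facts = delta_bounds[OF this(1)] mult_n_mono[OF this(1)] mult_n_mono[OF this(2)] first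
  show "0 < e1 b" "e1 b \<le> (3 * int p + 3) * int n"
    using facts assms unfolding e1_def ring_distribs mult.assoc mult_zero_left mult_1 by linarith+
qed

lemma e2_bounds:
  assumes "b \<le> p"
  shows "0 < e2 b" "e2 b \<le> (3 * int p + 3) * int n"
proof -
  have "0 \<le> int p - int b" "int p - int b \<le> int p" using assms by auto
  note facts = delta_bounds[OF this(1)] mult_n_mono[OF this(1)] mult_n_mono[OF this(2)] last three
  show "0 < e2 b" "e2 b \<le> (3 * int p + 3) * int n"
    using facts assms unfolding e2_def ring_distribs mult.assoc mult_zero_left mult_1 by linarith+
qed

lemma o1_upper:
  assumes "b < p"
  shows "o1 b \<le> (4 * int p + 6) * int n"
proof -
  have "0 \<le> int b" by simp
  note facts = delta_bounds[OF this] mult_n_mono[OF this] first up(2)[OF assms]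
  show ?thesis
    using facts assms unfolding o1_def ring_distribs mult.assoc mult_zero_left mult_1 by linarith
qed

text \<open>The entry \<open>F (2 * b + 1)\<close> exceeds the remaining climb
  \<open>(p - b) * \<delta>\<close>, at most \<open>3 * (p - b) * n\<close>, by more than
  \<open>2 * n\<close>; for \<open>e2\<close> this surplus also absorbs \<open>F a\<close>.\<close>

lemma o1_e1:
  assumes "b < p" "c \<le> p"
  shows "e1 c < o1 b"
proof -
  have "int c * \<delta> \<le> int p * \<delta>" using assms delta by (intro mult_right_mono) auto
  moreover have "0 \<le> int p - int b" using assms by simp
  note delta_bounds[OF this] mult_n_mono[OF this]
  ultimately show ?thesis
    using assms n_pos up(1)[OF assms(1)] unfolding o1_def e1_def ring_distribs mult.assoc mult_zero_left mult_1 by linarith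
qed

lemma o1_e2:
  assumes "b < p" "c \<le> p"
  shows "e2 c < o1 b"
proof -
  have "(int p - int c) * \<delta> \<le> int p * \<delta>" using assms delta by (intro mult_right_mono) auto
  moreover have "0 \<le> int p - int b" using assms by simp
  note delta_bounds[OF this] mult_n_mono[OF this]
  ultimately show ?thesis
    using assms n_pos middle up(1)[OF assms(1)] unfolding o1_def e2_def ring_distribs mult.assoc mult_zero_left mult_1 by linarith
qed

text \<open>Here \<open>o2 b\<close> is \<open>e2 (b + 1)\<close> minus the second entry of the
  pair. The bounds on the first entry alone are too weak when \<open>b = p - 1\<close>.\<close>

lemma o2_neg:
  assumes "b < p"
  shows "o2 b < 0"
proof -
  have "0 \<le> int p - int b - 1" using assms by simp
  note facts = delta_bounds[OF this] mult_n_mono[OF this]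
  show ?thesis
    using facts assms last three down(3,4)[OF assms] unfolding o2_def ring_distribs mult.assoc mult_zero_left mult_1 by linarith
qed

lemma o2_lower:
  assumes "b < p"
  shows "- (4 * int p * int n) \<le> o2 b"
proof -
  have "0 \<le> int p - int b" "0 \<le> int b" "1 \<le> int p" using assms by auto
  note facts = delta_bounds[OF this(1)] mult_n_mono[OF this(1)] mult_n_mono[OF this(2)] mult_n_mono[OF this(3)]
  show ?thesis
    using facts assms last three down(2)[OF assms] unfolding o2_def ring_distribs mult.assoc mult_zero_left mult_1 by linarith
qed

text \<open>Over \<open>k = c - b\<close> pairs the entry drops by more than
  \<open>(4 * k - 1) * n\<close>, hence by more than \<open>3 * k * n\<close>, while the base rises
  by only \<open>k * \<delta>\<close>. This is where \<open>\<delta> < 3 * n\<close> matters;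
  \<open>o2\<close> is symmetric.\<close>

lemma o1_decreasing:
  assumes "b < c" "c < p"
  shows "o1 c < o1 b"
proof -
  have "0 \<le> int c - int b" "1 \<le> int c - int b" "b < p" using assms by auto
  note facts = delta_bounds[OF this(1)] mult_n_mono[OF this(2)] up(1)[OF this(3)] up(2)[OF assms(2)]
  show ?thesis
    using facts assms unfolding o1_def ring_distribs mult.assoc mult_zero_left mult_1 by linarith
qed

lemma o2_increasing:
  assumes "b < c" "c < p"
  shows "o2 b < o2 c"
proof -
  have "0 \<le> int c - int b" "1 \<le> int c - int b" "b < p" using assms by auto
  note facts = delta_bounds[OF this(1)] mult_n_mono[OF this(2)] down(1)[OF this(3)] down(2)[OF assms(2)]
  show ?thesis
    using facts assms unfolding o2_def ring_distribs mult.assoc mult_zero_left mult_1 by linarith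
qed

lemma e1_eq: "e1 b = e1 c \<longleftrightarrow> b = c" and e2_eq: "e2 b = e2 c \<longleftrightarrow> b = c"
  using delta n_pos by (auto simp: e1_def e2_def)

lemma e1_neq_e2: "e1 b \<noteq> e2 c"
proof
  assume "e1 b = e2 c"
  then have "F a = (int b - (int p - int c)) * \<delta>"
    by (simp add: e1_def e2_def algebra_simps)
  then have "\<delta> dvd F a" by simp
  then have "\<bar>\<delta>\<bar> \<le> \<bar>F a\<bar>" using middle(1) by (rule dvd_imp_le_int[rotated])
  with middle delta show False by simp
qed


text \<open>Since \<open>Q\<close> is constant across empty diagonals, \<open>a\<close> and
  \<open>2 * a\<close> complete the families \<open>e1\<close> and \<open>e2\<close> as their
  members \<open>b = p\<close>.\<close>

lemma D_cases:
  assumes "d \<in> filled p a"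
  obtains "d = 0" "Q d = 0"
  | b where "b \<le> p" "d = (if b < p then 2 * b + 1 else a)" "Q d = e1 b"
  | b where "b < p" "d = 2 * b + 2" "Q d = o1 b"
  | b where "b \<le> p" "d = (if b < p then a + 2 * b + 1 else 2 * a)" "Q d = e2 b"
  | b where "b < p" "d = a + 2 * b + 2" "Q d = o2 b"
proof -
  have block: "\<exists>b<p. d = c + 2 * b + 1 \<or> d = c + 2 * b + 2" if "c < d" "d \<le> c + 2 * p" for c
    using that by (intro exI[of _ "(d - c - 1) div 2"]) presburger
  consider "d = 0" | "d = a" | "d = 2 * a" | b where "b < p" "d = 2 * b + 1" | b where "b < p" "d = 2 * b + 2"
    | b where "b < p" "d = a + 2 * b + 1" | b where "b < p" "d = a + 2 * b + 2"
    using assms block[of 0] block[of a] unfolding filled_def by fastforce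
  then show ?thesis
  proof cases
    case 1
    then show ?thesis using that(1) by (simp add: Q_def)
  next
    case 2
    then show ?thesis using that(2)[of p] by (simp add: Q_a e1_def)
  next
    case 3
    then show ?thesis using that(4)[of p] by (simp add: Q_2a e2_def)
  next
    case (4 b)
    then show ?thesis using that(2)[of b] Q_up[of b] by (simp add: e1_def)
  next
    case (5 b)
    then show ?thesis using that(3)[of b] Q_up[of b] Q_Suc[of "2 * b + 1"] by (simp add: o1_def)
  next
    case (6 b)
    then show ?thesis using that(4)[of b] Q_down[of b] by (simp add: e2_def)
  next
    case (7 b)
    then show ?thesis using that(5)[of b] Q_down[of b] Q_Suc[of "a + 2 * b + 1"] by (simp add: o2_def)
  qed
qed

lemma Q_inj: "inj_on Q (filled p a)"
proof (rule inj_onI)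
  have o1: "o1 b = o1 c \<longleftrightarrow> b = c" if "b < p" "c < p" for b c
    using that o1_decreasing[of b c] o1_decreasing[of c b] by (cases b c rule: linorder_cases) auto
  have o2: "o2 b = o2 c \<longleftrightarrow> b = c" if "b < p" "c < p" for b c
    using that o2_increasing[of b c] o2_increasing[of c b] by (cases b c rule: linorder_cases) auto
  have neq: "b \<le> p \<Longrightarrow> e1 b \<noteq> 0" "b \<le> p \<Longrightarrow> e2 b \<noteq> 0" "b < p \<Longrightarrow> o1 b \<noteq> 0" "b < p \<Longrightarrow> o2 b \<noteq> 0"
    "b < p \<Longrightarrow> c \<le> p \<Longrightarrow> o1 b \<noteq> e1 c" "b < p \<Longrightarrow> c \<le> p \<Longrightarrow> o1 b \<noteq> e2 c"
    "b < p \<Longrightarrow> c \<le> p \<Longrightarrow> o2 b \<noteq> e1 c" "b < p \<Longrightarrow> c \<le> p \<Longrightarrow> o2 b \<noteq> e2 c"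
    "b < p \<Longrightarrow> c < p \<Longrightarrow> o1 b \<noteq> o2 c" for b c
    using e1_bounds(1)[of b] e1_bounds(1)[of c] e2_bounds(1)[of b] e2_bounds(1)[of c]
      o1_e1[of b b] o1_e1[of b c] o1_e2[of b c] o2_neg[of b] o2_neg[of c] by linarith+
  note eqs = e1_eq e2_eq e1_neq_e2 e1_neq_e2[symmetric] o1 o2 neq neq[symmetric]
  fix d d'
  assume d: "d \<in> filled p a" and d': "d' \<in> filled p a"
    and eq: "Q d = Q d'"
  show "d = d'"
    by (rule D_cases[OF d]; rule D_cases[OF d']; insert eq; simp add: eqs)
qed

lemma Q_range:
  assumes "d \<in> filled p a"
  shows "- (4 * int p * int n) \<le> Q d" "Q d \<le> (4 * int p + 6) * int n"
proof -
  have le: "(3 * int p + 3) * int n \<le> (4 * int p + 6) * int n"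
    and pos: "0 \<le> 4 * int p * int n" "0 \<le> (4 * int p + 6) * int n"
    by (auto intro: mult_right_mono)
  have "- (4 * int p * int n) \<le> Q d \<and> Q d \<le> (4 * int p + 6) * int n"
    using assms
  proof (cases rule: D_cases[of d])
    case 1
    then show ?thesis using pos by simp
  next
    case (2 b)
    then show ?thesis using e1_bounds[of b] le pos by linarith
  next
    case (3 b)
    then show ?thesis using o1_upper[of b] o1_e1[of b b] e1_bounds[of b] pos by linarith
  next
    case (4 b)
    then show ?thesis using e2_bounds[of b] le pos by linarith
  next
    case (5 b)
    then show ?thesis using o2_lower[of b] o2_neg[of b] pos by linarith
  qed
  then show "- (4 * int p * int n) \<le> Q d" "Q d \<le> (4 * int p + 6) * int n" by auto
qed

text \<open>The range of \<open>Q\<close> has length \<open>(8 * p + 6) * n\<close>, one less than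
  the modulus, so congruent values would be equal.\<close>

lemma Q_not_cong:
  assumes "d \<in> filled p a" "d' \<in> filled p a"
    and "d \<noteq> d'"
  shows "\<not> [Q d = Q d'] (mod (2 * int n * int (4 * p + 3) + 1))"
proof
  let ?m = "2 * int n * int (4 * p + 3) + 1"
  assume "[Q d = Q d'] (mod ?m)"
  then have dvd: "?m dvd Q d - Q d'" by (simp add: cong_iff_dvd_diff)
  have "Q d - Q d' \<noteq> 0" using inj_onD[OF Q_inj, of d d'] assms by auto
  then have "\<bar>?m\<bar> \<le> \<bar>Q d - Q d'\<bar>" using dvd by (rule dvd_imp_le_int)
  moreover have "?m = 8 * (int p * int n) + 6 * int n + 1" by (simp add: algebra_simps)
  ultimately show False
    using Q_range[OF assms(1)] Q_range[OF assms(2)] n_pos unfolding ring_distribs mult.assoc mult_zero_left mult_1 by linarith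
qed

text \<open>The cyclically next filled diagonal; no partial sum changes in between.\<close>

definition succ :: "nat \<Rightarrow> nat" where
  "succ d = (if d = 2 * a then 0 else if d = a + 2 * p then 2 * a else if d = 2 * p then a else Suc d)"

text \<open>This is the form needed for rows. The sum after a filled diagonal is the sum before the
  next one, and \<open>succ\<close> permutes the filled diagonals.\<close>

lemma Q_Suc_not_cong:
  assumes "d \<in> filled p a" "d' \<in> filled p a"
    and "d \<noteq> d'"
  shows "\<not> [Q (Suc d) = Q (Suc d')] (mod (2 * int n * int (4 * p + 3) + 1))"
proof -
  have "Q (Suc c) = Q (succ c)" if "c \<in> filled p a" for c
    using that Q_a Q_2a Q_up[of p] Q_down[of p] Q_end[of "Suc (2 * a)"]
    by (auto simp: succ_def filled_def Q_def)
  moreover have "succ c \<in> filled p a"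
    if "c \<in> filled p a" for c
    using that p_less by (auto simp: succ_def filled_def)
  moreover have "succ d \<noteq> succ d'"
    using assms p_less by (auto simp: succ_def filled_def split: if_splits)
  ultimately show ?thesis
    using Q_not_cong assms by metis
qed

end

section \<open>The array on three diagonals\<close>

text \<open>Even positions run through 8L+1..10L, whose complements to 16L+1 are 6L+1..8L; odd
  positions run through 4L+1..6L. Placing 4L+1 at 2L-1 delays the later odd values by one
  step.\<close>

definition zeta0 :: "int \<Rightarrow> int \<Rightarrow> int" where
  "zeta0 L t = (if even t then 8 * L + 1 + t div 2
    else if t < 2 * L - 1 then 4 * L + 2 + t div 2
    else if t = 2 * L - 1 then 4 * L + 1
    else 4 * L + 1 + t div 2)"

text \<open>
  For \<open>L > 1\<close>, without the reflection at \<open>L - 1\<close> the sums \<open>\<bar>\<zeta> s + \<zeta> (s - 1) - K\<bar>\<close> would take the values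
  \<open>3 * L\<close> and \<open>3 * L - 1\<close> twice and miss \<open>4 * L\<close> and \<open>4 * L - 1\<close>.
\<close>

definition zeta :: "int \<Rightarrow> int \<Rightarrow> int" where
  "zeta L s = (let t = s mod (4 * L) in
    if t = L - 1 then 16 * L + 1 - zeta0 L t else zeta0 L t)"

definition link :: "int \<Rightarrow> int \<Rightarrow> int" where
  "link L s = zeta L s + zeta L (s - 1) - (16 * L + 1)"

lemma zeta_cong: "[s = t] (mod 4 * L) \<Longrightarrow> zeta L s = zeta L t"
  by (simp add: zeta_def cong_def)

lemma zeta_small:
  "0 \<le> t \<Longrightarrow> t < 4 * L \<Longrightarrow> zeta L t = (if t = L - 1 then 16 * L + 1 - zeta0 L t else zeta0 L t)"
  by (simp add: zeta_def)

lemma link_cong: "[s = t] (mod 4 * L) \<Longrightarrow> link L s = link L t"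
  using zeta_cong[of s t L] zeta_cong[of "s - 1" "t - 1" L] by (simp add: link_def cong_diff)

lemma zeta0_bounds:
  assumes "0 \<le> t" "t < 4 * L"
  shows "4 * L < zeta0 L t" "zeta0 L t \<le> 12 * L"
  using assms unfolding zeta0_def by (auto elim!: evenE oddE)

lemma zeta_bounds:
  assumes "0 < L"
  shows "4 * L < zeta L s" "zeta L s \<le> 12 * L"
proof -
  have "0 \<le> s mod (4 * L)" "s mod (4 * L) < 4 * L" using assms by auto
  from zeta0_bounds[OF this] show "4 * L < zeta L s" "zeta L s \<le> 12 * L"
    by (auto simp: zeta_def Let_def)
qed

lemma link_0: "0 < L \<Longrightarrow> link L 0 = (if L = 1 then - 3 else - 2 * L)"
proof -
  assume L: "0 < L"
  have "zeta L (- 1) = zeta L (4 * L - 1)" by (rule zeta_cong) (simp add: cong_iff_dvd_diff)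
  moreover have "(4 * L - 1) div 2 = 2 * L - 1" by presburger
  ultimately show ?thesis
    using L by (auto simp: link_def zeta_small zeta0_def)
qed

text \<open>Reflecting one of two neighbours turns their sum into a difference, in which the halves
  of \<open>t\<close> cancel; so the links at \<open>L - 1\<close> and \<open>L\<close> become
  extremal, in an order set by the parity of \<open>L\<close>.\<close>

lemma abs_link:
  assumes "0 < t" "t < 4 * L"
  shows "\<bar>link L t\<bar> =
    (if t = L - 1 then (if even L then 4 * L - 1 else 4 * L)
     else if t = L then (if even L then 4 * L else if L = 1 then 4 else 4 * L - 1)
     else if t < 2 * L - 1 then 4 * L - 1 - t
     else if t = 2 * L - 1 then 3 * L
     else if t = 2 * L then 3 * L - 1
     else 4 * L - t)"
proof (cases "even t")
  case True
  then obtain i where t: "t = 2 * i" by (elim evenE)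
  have div: "(2 * i - 1) div 2 = i - 1" by presburger
  have "zeta0 L t = 8 * L + 1 + i" using t by (simp add: zeta0_def)
  then have "zeta L t = (if t = L - 1 then 8 * L - i else 8 * L + 1 + i)"
    using assms by (auto simp: zeta_small)
  moreover have "zeta L (t - 1) = (let z = (if 2 * i < 2 * L then 4 * L + 1 + i else if i = L then 4 * L + 1 else 4 * L + i) in
      if t = L then 16 * L + 1 - z else z)"
    using assms t by (auto simp: zeta_small zeta0_def div Let_def)
  moreover have "t = L - 1 \<Longrightarrow> odd L" "t = L \<Longrightarrow> even L" using True by auto
  ultimately show ?thesis
    using assms t by (auto simp: link_def Let_def)
next
  case False
  then obtain i where t: "t = 2 * i + 1" by (elim oddE)
  have "zeta L (t - 1) = (if t = L then 8 * L - i else 8 * L + 1 + i)"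
    using assms t by (simp add: zeta_small zeta0_def)
  moreover have "zeta L t = (let z = (if 2 * i + 1 < 2 * L - 1 then 4 * L + 2 + i else if i = L - 1 then 4 * L + 1 else 4 * L + 1 + i) in
      if t = L - 1 then 16 * L + 1 - z else z)"
    using assms t by (auto simp: zeta_small zeta0_def Let_def)
  moreover have "t \<noteq> 2 * L" using False by auto
  ultimately show ?thesis
    using assms t by (auto simp: link_def Let_def)
qed

lemma link_bounds:
  assumes "0 < L"
  shows "link L s \<noteq> 0" "\<bar>link L s\<bar> \<le> 4 * L"
proof -
  define t where "t = s mod (4 * L)"
  have t: "0 \<le> t" "t < 4 * L" using assms by (auto simp: t_def)
  have "link L s = link L t" by (rule link_cong) (simp add: t_def)
  moreover have "link L t \<noteq> 0 \<and> \<bar>link L t\<bar> \<le> 4 * L"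
  proof (cases "t = 0")
    case True
    then show ?thesis using assms link_0[of L] by auto
  next
    case False
    then show ?thesis using abs_link[of t L] t by (auto split: if_splits)
  qed
  ultimately show "link L s \<noteq> 0" "\<bar>link L s\<bar> \<le> 4 * L" by auto
qed

lemma link_surj:
  assumes "1 \<le> v" "v \<le> 4 * L"
  shows "\<exists>t. \<bar>link L t\<bar> = v"
proof -
  have L: "0 < L" using assms by simp
  \<comment> \<open>\<open>L = 1\<close> is set apart because the reflected position
    \<open>L - 1\<close> is then 0, and \<open>2 * L - 1\<close> coincides with
    \<open>L\<close>.\<close>
  consider "v < 2 * L" | "v = 2 * L" "L \<noteq> 1" | "v = 3 * L - 1" | "v = 3 * L" "L \<noteq> 1"
    | "2 * L < v" "v < 4 * L - 1" "v \<noteq> 3 * L" "v \<noteq> 3 * L - 1"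
    | "v = 4 * L - 1" "L \<noteq> 1" | "v = 4 * L" "L \<noteq> 1" | "v = 3" "L = 1" | "v = 4" "L = 1"
    using assms by linarith
  then show ?thesis
  proof cases
    case 1
    then show ?thesis using assms by (intro exI[of _ "4 * L - v"]) (auto simp: abs_link)
  next
    case 2
    then show ?thesis using L by (intro exI[of _ 0]) (auto simp: link_0)
  next
    case 3
    then show ?thesis using L by (intro exI[of _ "2 * L"]) (auto simp: abs_link)
  next
    case 4
    then show ?thesis using L by (intro exI[of _ "2 * L - 1"]) (auto simp: abs_link)
  next
    case 5
    then show ?thesis by (intro exI[of _ "4 * L - 1 - v"]) (auto simp: abs_link)
  next
    case 6
    then show ?thesis using L by (intro exI[of _ "if even L then L - 1 else L"]) (auto simp: abs_link)
  next
    case 7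
    then show ?thesis using L by (intro exI[of _ "if even L then L else L - 1"]) (auto simp: abs_link)
  next
    case 8
    then show ?thesis by (intro exI[of _ 0]) (auto simp: link_0)
  next
    case 9
    then show ?thesis by (intro exI[of _ 1]) (auto simp: abs_link)
  qed
qed

lemma zeta_surj:
  assumes "4 * L < v" "v \<le> 12 * L"
  shows "\<exists>t. zeta L t = v \<or> 16 * L + 1 - zeta L t = v"
proof -
  have "\<exists>t. 0 \<le> t \<and> t < 4 * L \<and> (zeta0 L t = v \<or> 16 * L + 1 - zeta0 L t = v)"
  proof -
    \<comment> \<open>Passing to the smaller member of the pair is harmless, as the claim is
      symmetric under complement.\<close>
    define w where "w = min v (16 * L + 1 - v)"
    have w: "4 * L < w" "w \<le> 8 * L" "w = v \<or> 16 * L + 1 - w = v" using assms by (auto simp: w_def)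
    consider "w = 4 * L + 1" | "4 * L + 1 < w" "w \<le> 5 * L" | "5 * L < w" "w \<le> 6 * L" "w \<noteq> 4 * L + 1" | "6 * L < w"
      using w by linarith
    then have "\<exists>t. 0 \<le> t \<and> t < 4 * L \<and> (zeta0 L t = w \<or> 16 * L + 1 - zeta0 L t = w)"
    proof cases
      case 1
      then show ?thesis using w by (intro exI[of _ "2 * L - 1"]) (auto simp: zeta0_def)
    next
      case 2
      then show ?thesis by (intro exI[of _ "2 * (w - 4 * L - 2) + 1"]) (auto simp: zeta0_def)
    next
      case 3
      then show ?thesis by (intro exI[of _ "2 * (w - 4 * L - 1) + 1"]) (auto simp: zeta0_def)
    next
      case 4
      then show ?thesis using w by (intro exI[of _ "2 * (8 * L - w)"]) (auto simp: zeta0_def)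
    qed
    then show ?thesis using w by auto
  qed
  then obtain t where "0 \<le> t" "t < 4 * L" "zeta0 L t = v \<or> 16 * L + 1 - zeta0 L t = v" by blast
  \<comment> \<open>At the reflected position the two disjuncts merely swap.\<close>
  then show ?thesis by (intro exI[of _ t]) (auto simp: zeta_small)
qed

section \<open>The full array\<close>

text \<open>
  The absolute values above \<open>3 * n\<close> are cut into intervals of length \<open>n\<close>, one for each diagonal
  of the two blocks; the column index selects the position in the interval. The second
  diagonal of a pair uses column \<open>j - 1\<close>, so that in a row both entries have the same position.
\<close>

definition up_entry :: "nat \<Rightarrow> nat \<Rightarrow> nat \<Rightarrow> nat \<Rightarrow> int" where
  "up_entry n p d j = (let q = int p - int ((d - 1) div 2) in
    if odd d then (4 * q + 2) * int n + 1 + int j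
    else - (4 * q * int n + 1 + int ((j + n - 1) mod n)))"

definition down_entry :: "nat \<Rightarrow> nat \<Rightarrow> nat \<Rightarrow> nat \<Rightarrow> int" where
  "down_entry n p d j = (let q = int p - int ((d - 1) div 2) in
    if odd d then - ((4 * q + 1) * int n + 1 + int j)
    else (4 * q - 1) * int n + 1 + int ((j + n - 1) mod n))"

text \<open>Zigzag position \<open>s\<close> and column \<open>j\<close> are separate arguments: a
  row fixes \<open>s\<close> and moves \<open>j\<close>, a column does the reverse.\<close>

definition cell :: "nat \<Rightarrow> nat \<Rightarrow> nat \<Rightarrow> int \<Rightarrow> nat \<Rightarrow> int option" where
  "cell L p d s j = (let n = 4 * L; a = 2 * L - 1 in
    if d = 0 then Some (16 * int L + 1 - zeta (int L) (s - 1))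
    else if d = a then Some (link (int L) s)
    else if d = 2 * a then Some (- zeta (int L) s)
    else if d \<le> 2 * p then Some (up_entry n p d j)
    else if a < d \<and> d \<le> a + 2 * p then Some (down_entry n p (d - a) j)
    else None)"

definition diagonal_array :: "nat \<Rightarrow> nat \<Rightarrow> array" where
  "diagonal_array L p i j =
    cell L p ((j + 4 * L - i) mod (4 * L)) ((2 * int L - 1) * int i) j"

lemma cell_filled: "cell L p d s j \<noteq> None \<longleftrightarrow> d \<in> filled p (2 * L - 1)"
  by (auto simp: cell_def filled_def Let_def)

text \<open>\<open>shift\<close> makes the three main entries cancel. Paired block entries lie two
  intervals apart, whence the \<open>8 * L\<close> in \<open>pairs\<close>.\<close>

lemma heffter_line_cell:
  fixes s :: "nat \<Rightarrow> int" and j :: "nat \<Rightarrow> nat"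
  assumes p: "p < L"
    and shift: "zeta (int L) (s 0 - 1) = zeta (int L) (s (2 * L - 1)) + zeta (int L) (s (2 * L - 1) - 1) - zeta (int L) (s (2 * (2 * L - 1)))"
    and j: "\<And>d. j d < 4 * L"
    and \<delta>: "4 * int L < \<delta>" "\<delta> < 3 * (4 * int L)"
    and pairs: "\<And>d. 8 * int L + int (j d) - int ((j (Suc d) + 4 * L - 1) mod (4 * L)) = \<delta>"
  shows "heffter_line (4 * L) p (2 * L - 1) (\<lambda>d. entry (cell L p d (s d) (j d))) \<delta>"
proof
  let ?n = "4 * L" and ?a = "2 * L - 1"
  let ?F = "\<lambda>d. entry (cell L p d (s d) (j d))"
  let ?j' = "\<lambda>d. (j d + ?n - 1) mod ?n"
  have L: "0 < int L" using p by simp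
  have F0: "?F 0 = 16 * int L + 1 - zeta (int L) (s 0 - 1)"
    by (simp add: cell_def entry_def)
  have Fa: "?F ?a = link (int L) (s ?a)"
    using p by (simp add: cell_def entry_def)
  have F2a: "?F (2 * ?a) = - zeta (int L) (s (2 * ?a))"
    using p by (simp add: cell_def entry_def)
  show "2 * p < ?a" "2 * ?a < ?n" using p by auto
  show "int ?n < \<delta>" "\<delta> < 3 * int ?n" using \<delta> by auto
  show "int ?n < ?F 0" "?F 0 \<le> 3 * int ?n"
    using zeta_bounds[OF L, of "s 0 - 1"] unfolding F0 by auto
  show "?F ?a \<noteq> 0" "\<bar>?F ?a\<bar> \<le> int ?n"
    using link_bounds[OF L, of "s ?a"] unfolding Fa by auto
  show "?F (2 * ?a) < - int ?n" "- 3 * int ?n \<le> ?F (2 * ?a)"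
    using zeta_bounds[OF L, of "s (2 * ?a)"] unfolding F2a by auto
  show "?F 0 + ?F ?a + ?F (2 * ?a) = 0"
    using shift unfolding F0 Fa F2a by (simp add: link_def)
  show "?F d = 0" if "d \<notin> filled p ?a" for d
    using that cell_filled[of L p d "s d" "j d"] by (simp add: entry_def)
  have j': "?j' d < ?n" for d using p by simp
  fix b assume b: "b < p"
  let ?q = "int p - int b"
  have up1: "?F (2 * b + 1) = (4 * ?q + 2) * int ?n + 1 + int (j (2 * b + 1))"
    using b p by (auto simp: cell_def entry_def up_entry_def Let_def)
  have up2: "?F (2 * b + 2) = - (4 * ?q * int ?n + 1 + int (?j' (2 * b + 2)))"
    using b p by (auto simp: cell_def entry_def up_entry_def Let_def)
  have down1: "?F (?a + 2 * b + 1) = - ((4 * ?q + 1) * int ?n + 1 + int (j (?a + 2 * b + 1)))"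
    using b p by (auto simp: cell_def entry_def down_entry_def Let_def)
  have down2: "?F (?a + 2 * b + 2) = (4 * ?q - 1) * int ?n + 1 + int (?j' (?a + 2 * b + 2))"
    using b p by (auto simp: cell_def entry_def down_entry_def Let_def)
  show "(4 * ?q + 2) * int ?n < ?F (2 * b + 1)" unfolding up1 by simp
  show "?F (2 * b + 1) \<le> (4 * ?q + 3) * int ?n"
    using j[of "2 * b + 1"] unfolding up1 by (simp add: algebra_simps)
  show "?F (2 * b + 1) + ?F (2 * b + 2) = \<delta>"
    using pairs[of "2 * b + 1"] unfolding up1 up2 by (simp add: algebra_simps)
  show "?F (?a + 2 * b + 1) < - ((4 * ?q + 1) * int ?n)" unfolding down1 by simp
  show "- ((4 * ?q + 2) * int ?n) \<le> ?F (?a + 2 * b + 1)"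
  proof -
    obtain u where "u < ?n" "?F (?a + 2 * b + 1) = - ((4 * ?q + 1) * int ?n + 1 + int u)"
      using down1 j by blast
    then show ?thesis by (simp add: algebra_simps)
  qed
  show "?F (?a + 2 * b + 1) + ?F (?a + 2 * b + 2) = - \<delta>"
    using pairs[of "?a + 2 * b + 1"] unfolding down1 down2 by (simp add: algebra_simps)
  show "(4 * ?q - 1) * int ?n < ?F (?a + 2 * b + 2)" unfolding down2 by simp
qed

lemma row_line:
  assumes "p < L" "i < 4 * L"
  shows "heffter_line (4 * L) p (2 * L - 1)
    (\<lambda>d. entry (cell L p d ((2 * int L - 1) * int i) ((i + d) mod (4 * L)))) (8 * int L)"
proof (rule heffter_line_cell)
  show "8 * int L + int ((i + d) mod (4 * L)) - int (((i + Suc d) mod (4 * L) + 4 * L - 1) mod (4 * L)) = 8 * int L" for d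
  proof -
    have "((i + Suc d) mod (4 * L) + (4 * L - 1)) mod (4 * L) = (i + Suc d + (4 * L - 1)) mod (4 * L)"
      by (rule mod_add_left_eq)
    also have "i + Suc d + (4 * L - 1) = (i + d) + 4 * L" using assms by simp
    finally show ?thesis using assms by simp
  qed
qed (use assms in auto)

text \<open>On diagonal \<open>d\<close> the row is \<open>j - d\<close>, at zigzag position
  \<open>a * (j - d)\<close>. As \<open>a * a\<close> is 1 modulo \<open>n\<close>, each step of
  \<open>a\<close> diagonals lowers the position by 1, which gives the telescoping.\<close>

lemma column_line:
  assumes p: "p < L" and j: "j < 4 * L"
  shows "heffter_line (4 * L) p (2 * L - 1)
    (\<lambda>d. entry (cell L p d ((2 * int L - 1) * int ((j + 4 * L - d) mod (4 * L))) j))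
    (8 * int L + int j - int ((j + 4 * L - 1) mod (4 * L)))"
proof (rule heffter_line_cell)
  let ?n = "4 * int L" and ?a = "2 * int L - 1"
  define s where "s d = ?a * int ((j + 4 * L - d) mod (4 * L))" for d
  have s: "[s d = ?a * (int j - int d)] (mod ?n)" if "d < 4 * L" for d
  proof -
    have "int ((j + 4 * L - d) mod (4 * L)) = (int j - int d + ?n) mod ?n"
      using that by (simp add: of_nat_mod of_nat_diff algebra_simps)
    then show ?thesis unfolding s_def by (simp add: cong_def mod_mult_right_eq)
  qed
  have sq: "?a * ?a = 1 + ?n * (int L - 1)" by (simp add: algebra_simps)
  have s0: "[s 0 - 1 = ?a * int j - 1] (mod ?n)"
    using s[of 0] p by (intro cong_diff) auto
  have sa: "[s (2 * L - 1) = ?a * int j - 1] (mod ?n)"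
  proof -
    have "[s (2 * L - 1) = ?a * (int j - ?a)] (mod ?n)" using s[of "2 * L - 1"] p by (simp add: of_nat_diff)
    also have "?a * (int j - ?a) = ?a * int j - 1 + ?n * (1 - int L)" using sq by (simp add: algebra_simps)
    also have "[\<dots> = ?a * int j - 1] (mod ?n)" by (simp add: cong_def)
    finally show ?thesis .
  qed
  have s2a: "[s (2 * (2 * L - 1)) = s (2 * L - 1) - 1] (mod ?n)"
  proof -
    have "[s (2 * (2 * L - 1)) = ?a * (int j - 2 * ?a)] (mod ?n)"
      using s[of "2 * (2 * L - 1)"] p by (simp add: of_nat_diff)
    also have "?a * (int j - 2 * ?a) = ?a * int j - 1 - 1 + ?n * (2 * (1 - int L))" using sq by (simp add: algebra_simps)
    also have "[\<dots> = ?a * int j - 1 - 1] (mod ?n)" by (simp add: cong_def)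
    also have "[?a * int j - 1 - 1 = s (2 * L - 1) - 1] (mod ?n)"
      using sa by (intro cong_diff) (auto simp: cong_sym)
    finally show ?thesis .
  qed
  show "zeta (int L) (?a * int ((j + 4 * L - 0) mod (4 * L)) - 1) =
    zeta (int L) (?a * int ((j + 4 * L - (2 * L - 1)) mod (4 * L))) +
    zeta (int L) (?a * int ((j + 4 * L - (2 * L - 1)) mod (4 * L)) - 1) -
    zeta (int L) (?a * int ((j + 4 * L - 2 * (2 * L - 1)) mod (4 * L)))"
    using zeta_cong[OF cong_trans[OF s0 cong_sym[OF sa]]] zeta_cong[OF s2a] unfolding s_def by simp
  \<comment> \<open>Here \<open>\<delta>\<close> is \<open>2 * n + 1\<close>, except
    \<open>n + 1\<close> in column 0.\<close>
  have "(j + 4 * L - 1) mod (4 * L) < 4 * L" using p by simp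
  then have "int ((j + 4 * L - 1) mod (4 * L)) < 4 * int L" by simp
  then show "4 * int L < 8 * int L + int j - int ((j + 4 * L - 1) mod (4 * L))"
    "8 * int L + int j - int ((j + 4 * L - 1) mod (4 * L)) < 3 * (4 * int L)"
    using j by linarith+
qed (use assms in auto)

section \<open>Lengths, totals and partial sums of the rows and columns\<close>

lemma card_filled: "2 * p < a \<Longrightarrow> card (filled p a) = 4 * p + 3"
proof -
  assume a: "2 * p < a"
  have "card (filled p a) = card ({..2 * p} \<union> {a..a + 2 * p}) + card {2 * a}"
    using a unfolding filled_def by (intro card_Un_disjoint) auto
  also have "card ({..2 * p} \<union> {a..a + 2 * p}) = card {..2 * p} + card {a..a + 2 * p}"
    using a by (intro card_Un_disjoint) auto
  finally show ?thesis by simp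
qed

lemma filled_less: "p < L \<Longrightarrow> d \<in> filled p (2 * L - 1) \<Longrightarrow> d < 4 * L"
  by (auto simp: filled_def)

lemma add_offset: "i < n \<Longrightarrow> t < n \<Longrightarrow> (i + (t + n - i) mod n) mod n = t" for i n t :: nat
  by (auto simp: mod_offset)

lemma offset_add: "i < n \<Longrightarrow> d < n \<Longrightarrow> ((i + d) mod n + n - i) mod n = d" for i n d :: nat
  by (auto simp: mod_if)

lemma offset_offset: "j < n \<Longrightarrow> t < n \<Longrightarrow> (j + n - (j + n - t) mod n) mod n = t" for j n t :: nat
  by (auto simp: mod_offset mod_if)

lemma card_row_offset:
  assumes "i < n" "D \<subseteq> {..<n}"
  shows "card {t. t < n \<and> (t + n - i) mod n \<in> D} = card (D :: nat set)"
proof (rule bij_betw_same_card[OF bij_betw_byWitness[where f' = "\<lambda>d. (i + d) mod n"]])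
  show "\<forall>t\<in>{t. t < n \<and> (t + n - i) mod n \<in> D}. (i + (t + n - i) mod n) mod n = t"
    using assms by (auto simp: add_offset)
  show "\<forall>d\<in>D. ((i + d) mod n + n - i) mod n = d"
    using assms by (auto simp: offset_add)
  then show "(\<lambda>d. (i + d) mod n) ` D \<subseteq> {t. t < n \<and> (t + n - i) mod n \<in> D}"
    using assms by auto
qed auto

lemma card_column_offset:
  assumes "j < n" "D \<subseteq> {..<n}"
  shows "card {t. t < n \<and> (j + n - t) mod n \<in> D} = card (D :: nat set)"
proof (rule bij_betw_same_card[OF bij_betw_byWitness[where f' = "\<lambda>d. (j + n - d) mod n"]])
  show "\<forall>t\<in>{t. t < n \<and> (j + n - t) mod n \<in> D}. (j + n - (j + n - t) mod n) mod n = t"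
    using assms by (auto simp: offset_offset)
  show "\<forall>d\<in>D. (j + n - (j + n - d) mod n) mod n = d"
    using assms by (auto simp: offset_offset)
  then show "(\<lambda>d. (j + n - d) mod n) ` D \<subseteq> {t. t < n \<and> (j + n - t) mod n \<in> D}"
    using assms by auto
qed auto

lemma row_properties:
  assumes p: "p < L" and i: "i < 4 * L"
  shows "length (row_entries (4 * L) (diagonal_array L p) i) = 4 * p + 3"
    and "sum_list (row_entries (4 * L) (diagonal_array L p) i) = 0"
    and "distinct_partial_sums (2 * int (4 * L) * int (4 * p + 3) + 1) (row_entries (4 * L) (diagonal_array L p) i)"
proof -
  let ?n = "4 * L"
  define F where "F = (\<lambda>d. entry (cell L p d ((2 * int L - 1) * int i) ((i + d) mod ?n)))"
  interpret heffter_line ?n p "2 * L - 1" F "8 * int L"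
    unfolding F_def using assms by (rule row_line)
  have F: "entry (diagonal_array L p i t) = F ((t + ?n - i) mod ?n)" if "t < ?n" for t
    using add_offset[OF i that] by (simp add: F_def diagonal_array_def)
  have filled: "diagonal_array L p i t \<noteq> None \<longleftrightarrow> (t + ?n - i) mod ?n \<in> filled p (2 * L - 1)" for t
    by (simp only: diagonal_array_def cell_filled)
  have total: "(\<Sum>d<?n. F d) = 0" using Q_n by (simp add: Q_def)
  have partial: "(\<Sum>u\<le>t. entry (diagonal_array L p i u)) = Q (Suc ((t + ?n - i) mod ?n)) - Q ((?n - i) mod ?n)"
    if "t < ?n" for t
  proof -
    have "(\<Sum>u\<le>t. entry (diagonal_array L p i u)) = (\<Sum>u\<le>t. F ((u + ?n - i) mod ?n))"
      using that F by (intro sum.cong) auto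
    then show ?thesis using row_partial_sum[OF i total that] by (simp add: Q_def)
  qed
  show "length (row_entries ?n (diagonal_array L p) i) = 4 * p + 3"
    unfolding row_entries_def length_map_filter_upt filled
    using card_row_offset[of i ?n "filled p (2 * L - 1)"] filled_less[OF p] card_filled[of p "2 * L - 1"] p i
    by auto
  have "(\<Sum>t<?n. entry (diagonal_array L p i t)) = (\<Sum>t\<le>?n - 1. entry (diagonal_array L p i t))"
    using i by (intro sum.cong) auto
  also have "\<dots> = 0"
  \<comment> \<open>The row ends just before its starting diagonal; for \<open>i = 0\<close> these
    ends are \<open>n\<close> and 0, where \<open>Q\<close> vanishes.\<close>
  proof (cases "i = 0")
    case True
    then have "Suc ((?n - 1 + ?n - i) mod ?n) = ?n" using mod_offset[of i ?n "?n - 1"] i by simp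
    then show ?thesis using partial[of "?n - 1"] i Q_0 Q_n True by (simp only:) simp
  next
    case False
    then have "Suc ((?n - 1 + ?n - i) mod ?n) = ?n - i" using mod_offset[of i ?n "?n - 1"] i by simp arith
    then show ?thesis using partial[of "?n - 1"] i False by simp
  qed
  finally show "sum_list (row_entries ?n (diagonal_array L p) i) = 0"
    by (simp add: row_entries_def sum_list_map_filter_upt)
  show "distinct_partial_sums (2 * int ?n * int (4 * p + 3) + 1) (row_entries ?n (diagonal_array L p) i)"
    unfolding row_entries_def
  proof (rule distinct_partial_sums_map_filter_upt)
    fix s t
    assume st: "s < ?n" "t < ?n" "diagonal_array L p i s \<noteq> None" "diagonal_array L p i t \<noteq> None" "s \<noteq> t"
    then have "(s + ?n - i) mod ?n \<noteq> (t + ?n - i) mod ?n"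
      using add_offset[OF i, of s] add_offset[OF i, of t] by metis
    with st show "\<not> [(\<Sum>u\<le>s. entry (diagonal_array L p i u)) = (\<Sum>u\<le>t. entry (diagonal_array L p i u))]
        (mod 2 * int ?n * int (4 * p + 3) + 1)"
      using Q_Suc_not_cong filled unfolding partial[OF st(1)] partial[OF st(2)]
      by (simp add: cong_iff_dvd_diff)
  qed
qed

lemma column_properties:
  assumes p: "p < L" and j: "j < 4 * L"
  shows "length (col_entries (4 * L) (diagonal_array L p) j) = 4 * p + 3"
    and "sum_list (col_entries (4 * L) (diagonal_array L p) j) = 0"
    and "distinct_partial_sums (2 * int (4 * L) * int (4 * p + 3) + 1) (col_entries (4 * L) (diagonal_array L p) j)"
proof -
  let ?n = "4 * L"
  define F where "F = (\<lambda>d. entry (cell L p d ((2 * int L - 1) * int ((j + ?n - d) mod ?n)) j))"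
  interpret heffter_line ?n p "2 * L - 1" F "8 * int L + int j - int ((j + 4 * L - 1) mod (4 * L))"
    unfolding F_def using assms by (rule column_line)
  have F: "entry (diagonal_array L p t j) = F ((j + ?n - t) mod ?n)" if "t < ?n" for t
    using offset_offset[OF j that] by (simp add: F_def diagonal_array_def)
  have filled: "diagonal_array L p t j \<noteq> None \<longleftrightarrow> (j + ?n - t) mod ?n \<in> filled p (2 * L - 1)" for t
    by (simp only: diagonal_array_def cell_filled)
  have total: "(\<Sum>d<?n. F d) = 0" using Q_n by (simp add: Q_def)
  have partial: "(\<Sum>u\<le>t. entry (diagonal_array L p u j)) = Q (Suc j) - Q ((j + ?n - t) mod ?n)"
    if "t < ?n" for t
  proof -
    have "(\<Sum>u\<le>t. entry (diagonal_array L p u j)) = (\<Sum>u\<le>t. F ((j + ?n - u) mod ?n))"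
      using that F by (intro sum.cong) auto
    then show ?thesis using column_partial_sum[OF j total that] by (simp add: Q_def)
  qed
  show "length (col_entries ?n (diagonal_array L p) j) = 4 * p + 3"
    unfolding col_entries_def length_map_filter_upt filled
    using card_column_offset[of j ?n "filled p (2 * L - 1)"] filled_less[OF p] card_filled[of p "2 * L - 1"] p j
    by auto
  have "(\<Sum>t<?n. entry (diagonal_array L p t j)) = (\<Sum>t\<le>?n - 1. entry (diagonal_array L p t j))"
    using j by (intro sum.cong) auto
  also have "\<dots> = 0"
  proof (cases "Suc j = ?n")
    case True
    then have "(j + ?n - (?n - 1)) mod ?n = 0" by auto
    then show ?thesis using partial[of "?n - 1"] Q_0 Q_n True by simp
  next
    case False
    then have "(j + ?n - (?n - 1)) mod ?n = Suc j" using j by (auto simp: mod_offset)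
    then show ?thesis using partial[of "?n - 1"] j by simp
  qed
  finally show "sum_list (col_entries ?n (diagonal_array L p) j) = 0"
    by (simp add: col_entries_def sum_list_map_filter_upt)
  show "distinct_partial_sums (2 * int ?n * int (4 * p + 3) + 1) (col_entries ?n (diagonal_array L p) j)"
    unfolding col_entries_def
  proof (rule distinct_partial_sums_map_filter_upt)
    fix s t
    assume st: "s < ?n" "t < ?n" "diagonal_array L p s j \<noteq> None" "diagonal_array L p t j \<noteq> None" "s \<noteq> t"
    then have "(j + ?n - s) mod ?n \<noteq> (j + ?n - t) mod ?n"
      using offset_offset[OF j, of s] offset_offset[OF j, of t] by metis
    with st have "\<not> [Q ((j + ?n - t) mod ?n) = Q ((j + ?n - s) mod ?n)] (mod 2 * int ?n * int (4 * p + 3) + 1)"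
      using Q_not_cong filled by metis
    then show "\<not> [(\<Sum>u\<le>s. entry (diagonal_array L p u j)) = (\<Sum>u\<le>t. entry (diagonal_array L p u j))]
        (mod 2 * int ?n * int (4 * p + 3) + 1)"
      unfolding partial[OF st(1)] partial[OF st(2)] by (simp add: cong_iff_dvd_diff)
  qed
qed

section \<open>Every value up to \<open>n * k\<close> occurs\<close>

lemma diagonal_array_at:
  assumes "d < 4 * L" "i < 4 * L"
  shows "diagonal_array L p i ((i + d) mod (4 * L)) = cell L p d ((2 * int L - 1) * int i) ((i + d) mod (4 * L))"
  using offset_add[OF assms(2,1)] by (simp add: diagonal_array_def)

lemma obtain_row:
  assumes "0 < L"
  obtains i where "i < 4 * L" "[(2 * int L - 1) * int i = s] (mod 4 * int L)"
proof -
  \<comment> \<open>The multiplier \<open>2 * L - 1\<close> is its own inverse modulo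
    \<open>4 * L\<close>.\<close>
  define i where "i = nat (((2 * int L - 1) * s) mod (4 * int L))"
  have i: "int i = ((2 * int L - 1) * s) mod (4 * int L)" using assms by (simp add: i_def)
  have "int i < int (4 * L)" unfolding i using assms by simp
  then have "i < 4 * L" by linarith
  moreover have "[(2 * int L - 1) * int i = (2 * int L - 1) * ((2 * int L - 1) * s)] (mod 4 * int L)"
    unfolding i by (simp add: cong_def mod_mult_right_eq)
  moreover have "(2 * int L - 1) * ((2 * int L - 1) * s) = s + 4 * int L * ((int L - 1) * s)"
    by (simp add: algebra_simps)
  moreover have "[s + 4 * int L * ((int L - 1) * s) = s] (mod 4 * int L)" by (simp add: cong_def)
  ultimately show ?thesis using that cong_trans by metis
qed

lemma diagonal_array_surj:
  assumes p: "p < L" and x: "1 \<le> x" "x \<le> int (4 * L) * int (4 * p + 3)"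
  shows "\<exists>i<4 * L. \<exists>j<4 * L. diagonal_array L p i j = Some x \<or> diagonal_array L p i j = Some (- x)"
proof -
  let ?n = "4 * L" and ?a = "2 * L - 1"
  have L: "0 < L" using p by simp
  have hit: ?thesis if "d < ?n" "i < ?n"
    "cell L p d ((2 * int L - 1) * int i) ((i + d) mod ?n) \<in> {Some x, Some (- x)}" for d i
    using that diagonal_array_at[OF that(1,2), of p] L
    by (intro exI[of _ i] conjI exI[of _ "(i + d) mod ?n"]) auto
  consider "x \<le> 4 * int L" | "4 * int L < x" "x \<le> 12 * int L" | "12 * int L < x" by linarith
  then show ?thesis
  proof cases
    case 1
    then obtain s where s: "\<bar>link (int L) s\<bar> = x" using link_surj x by blast
    obtain i where i: "i < ?n" "[(2 * int L - 1) * int i = s] (mod 4 * int L)" using obtain_row[OF L] .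
    show ?thesis
      using s link_cong[OF i(2)] L by (intro hit[of ?a i]) (auto simp: cell_def i)
  next
    case 2
    then obtain s where "zeta (int L) s = x \<or> 16 * int L + 1 - zeta (int L) s = x" using zeta_surj by blast
    then show ?thesis
    proof
      assume s: "zeta (int L) s = x"
      obtain i where i: "i < ?n" "[(2 * int L - 1) * int i = s] (mod 4 * int L)" using obtain_row[OF L] .
      show ?thesis
        using s zeta_cong[OF i(2)] L by (intro hit[of "2 * ?a" i]) (auto simp: cell_def i)
    next
      assume s: "16 * int L + 1 - zeta (int L) s = x"
      \<comment> \<open>The shift to \<open>s + 1\<close> compensates for diagonal 0 using position
        \<open>s - 1\<close>.\<close>
      obtain i where i: "i < ?n" "[(2 * int L - 1) * int i = s + 1] (mod 4 * int L)" using obtain_row[OF L] .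
      have "[(2 * int L - 1) * int i - 1 = s] (mod 4 * int L)" using cong_diff[OF i(2) cong_refl[of 1]] by simp
      from zeta_cong[OF this] show ?thesis
        using s L by (intro hit[of 0 i]) (auto simp: cell_def i)
    qed
  next
    case 3
    define \<sigma> where "\<sigma> = (x - 1) div int ?n"
    define w where "w = nat ((x - 1) mod int ?n)"
    have w: "int w = (x - 1) mod int ?n" using L by (simp add: w_def)
    have wn: "w < ?n" using L w by (metis of_nat_less_iff of_nat_0_less_iff pos_mod_bound mult_pos_pos zero_less_numeral)
    have xw: "x = \<sigma> * int ?n + 1 + int w" using div_mult_mod_eq[of "x - 1" "int ?n"] unfolding w \<sigma>_def by linarith
    define N where "N = int ?n"
    have "3 * N < x" "x \<le> (4 * int p + 3) * N" "x = \<sigma> * N + 1 + int w" "int w < N"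
      using 3 x(2) xw wn by (simp_all add: N_def mult.commute)
    then have "3 * N < (\<sigma> + 1) * N" "\<sigma> * N < (4 * int p + 3) * N"
      unfolding ring_distribs by linarith+
    moreover have "0 < N" using L by (simp add: N_def)
    ultimately have \<sigma>: "3 \<le> \<sigma>" "\<sigma> \<le> 4 * int p + 2"
      by (simp_all only: mult_less_cancel_right_pos)
    \<comment> \<open>The intervals numbered 4q-1 to 4q+2 belong to the pairs with index
      \<open>p - q\<close> in the two blocks.\<close>
    define q where "q = (\<sigma> + 1) div 4"
    define b where "b = nat (int p - q)"
    have q: "1 \<le> q" "q \<le> int p" "\<sigma> \<in> {4 * q - 1, 4 * q, 4 * q + 1, 4 * q + 2}"
      using \<sigma> unfolding q_def by auto
    have b: "int p - int b = q" "b < p" using q by (auto simp: b_def)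
    \<comment> \<open>The second diagonal of a pair reads its position from the previous
      column.\<close>
    define w' where "w' = (w + 1) mod ?n"
    have w': "(w' + ?n - 1) mod ?n = w" "w' < ?n"
      using wn L by (auto simp: w'_def mod_if)
    \<comment> \<open>Block entries depend only on diagonal and column, so the row can be solved
      for.\<close>
    have place: ?thesis if "d < ?n" "j < ?n" "\<And>s. cell L p d s j \<in> {Some x, Some (- x)}" for d j
      using hit[of d "(j + ?n - d) mod ?n"] that L offset_offset[of j ?n d]
      by (auto simp: add_offset mod_add_left_eq)
    consider "\<sigma> = 4 * q - 1" | "\<sigma> = 4 * q" | "\<sigma> = 4 * q + 1" | "\<sigma> = 4 * q + 2" using q(3) by auto
    then show ?thesis
    proof cases
      case 1
      show ?thesis
        by (rule place[of "?a + 2 * b + 2" w'])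
          (use p b w' xw 1 in \<open>auto simp: cell_def down_entry_def Let_def\<close>)
    next
      case 2
      show ?thesis
        by (rule place[of "2 * b + 2" w'])
          (use p b w' xw 2 in \<open>auto simp: cell_def up_entry_def Let_def\<close>)
    next
      case 3
      show ?thesis
        by (rule place[of "?a + 2 * b + 1" w])
          (use p b wn xw 3 in \<open>auto simp: cell_def down_entry_def Let_def\<close>)
    next
      case 4
      show ?thesis
        by (rule place[of "2 * b + 1" w])
          (use p b wn xw 4 in \<open>auto simp: cell_def up_entry_def Let_def\<close>)
    qed
  qed
qed

theorem theorem4p6:
  fixes n p \<epsilon> :: nat
  assumes "[n = 0] (mod 4)"
    and "n \<ge> 4 * p + 3"
    and "\<epsilon> > 0"
    and "real \<epsilon> \<le> (real n - 4 * real p) / 2"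
    and "gcd \<epsilon> n = 1"
    and "\<exists>\<alpha>::int. gcd \<alpha> (int n) = 1 \<and>
           2 * int p + int \<epsilon> \<le> \<alpha> \<and> \<alpha> \<le> int n - int \<epsilon> - 2 * int p"
  shows "\<exists>A. heffter_array n (4 * p + 3) A \<and> globally_simple n (4 * p + 3) A"
proof -
  obtain L where n: "n = 4 * L" using assms(1) by (auto simp: cong_0_iff)
  with assms(2) have p: "p < L" by simp
  have "heffter_array n (4 * p + 3) (diagonal_array L p)"
    unfolding heffter_array_def n
    using row_properties[OF p] column_properties[OF p] diagonal_array_surj[OF p] by (simp add: cong_refl)
  moreover have "globally_simple n (4 * p + 3) (diagonal_array L p)"
    unfolding globally_simple_def n using row_properties(3)[OF p] column_properties(3)[OF p] by blast
  ultimately show ?thesis by blast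
qed

end
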